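(* Let $X,E$ be Euclidean spaces, $A:X\to\mathbf{R}^m$ and $B:X\to E$ linear maps, $\phi(\cdot)$ a norm on $\mathbf{R}^m$, and let a sparsity structure $(\|\cdot\|,\mathcal{P},\nu,P\mapsto\overline{P})$ on $E$ be given. Let $s\ge0$ and let the condition $\mathbf{C}_s(\gamma,\beta;\phi)$ take place for some $0\le\gamma<1$ and $0\le\beta<\infty$. Let $\epsilon\ge 0$, let $x\in X$ and $y=Ax+\xi$ with $\xi\in\mathbf{R}^m$, $\phi(\xi)\le\epsilon$. Let $\delta_x,\delta_\phi,\delta\ge0$ and $\widehat{x}\in X$ be such that: (1) there exists $P\in\mathcal{P}_s$ such that $\|(I-P)Bx\|\le\delta_x$, where $I$ is the identity on $E$; (2) $\phi(A\widehat{x}-[Ax+\xi])\le\epsilon+\delta_\phi$ and $\|B\widehat{x}\|\le\mathrm{Opt}+\delta$, where $\mathrm{Opt}:=\min_{u\in X}\{\|Bu\|:\phi(Au-y)\le\epsilon\}$. Then $$\|B\widehat{x}-Bx\|\ \le\ \frac{\beta[2\epsilon+\delta_\phi]+\delta+2\delta_x}{1-\gamma}.$$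
   Context: Sparsity structure on a Euclidean space $E$: a norm $\|\cdot\|$ on $E$, with conjugate (dual) norm $\|\cdot\|_*$, together with a family $\mathcal{P}$ of linear maps of $E$ into itself such that: (A.1) every $P\in\mathcal{P}$ is a projector, $P^2=P$; (A.2) every $P\in\mathcal{P}$ is assigned a nonnegative weight $\nu(P)$ and a linear map $\overline{P}$ on $E$ such that $\overline{P}P=0$; (A.3) whenever $P\in\mathcal{P}$ and $f,g\in E$, one has $\|P^*f+\overline{P}^*g\|_*\le\max[\|f\|_*,\|g\|_*]$, where $Q^*$ denotes the conjugate (adjoint) of a linear map $Q$. For real $s\ge0$, $\mathcal{P}_s=\{P\in\mathcal{P}:\nu(P)\le s\}$. Condition $\mathbf{C}_s(\gamma,\beta;\phi)$: for all $z\in X$ and all $P\in\mathcal{P}_s$, $$\|PBz\|+\|Bz\|-\|\overline{P}Bz\|\le\beta\phi(Az)+\gamma\|Bz\|.$$ *)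

theory Defs
  imports "HOL-Analysis.Analysis"
begin

definition is_norm :: "('a::real_vector \<Rightarrow> real) \<Rightarrow> bool" where
  "is_norm N \<longleftrightarrow>
     (\<forall>v. 0 \<le> N v) \<and> (\<forall>v. N v = 0 \<longleftrightarrow> v = 0) \<and>
     (\<forall>c v. N (c *\<^sub>R v) = \<bar>c\<bar> * N v) \<and> (\<forall>v w. N (v + w) \<le> N v + N w)"

definition dual_norm :: "('a::real_inner \<Rightarrow> real) \<Rightarrow> 'a \<Rightarrow> real" where
  "dual_norm N f = (SUP v\<in>{v. N v \<le> 1}. f \<bullet> v)"

text \<open>The weight and the map \<open>bar P\<close> are constrained only for \<open>P\<close> in the family \<open>\<P>\<close>;
  \<open>adjoint\<close> is taken with respect to the inner product of the Euclidean space.\<close>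

locale sparsity_structure =
  fixes N :: "'e::euclidean_space \<Rightarrow> real"
    and \<P> :: "('e \<Rightarrow> 'e) set"
    and \<nu> :: "('e \<Rightarrow> 'e) \<Rightarrow> real"
    and bar :: "('e \<Rightarrow> 'e) \<Rightarrow> 'e \<Rightarrow> 'e"
  assumes norm: "is_norm N"
    and linear_family: "P \<in> \<P> \<Longrightarrow> linear P"
    and projector: "P \<in> \<P> \<Longrightarrow> P \<circ> P = P"
    and weight_nonneg: "P \<in> \<P> \<Longrightarrow> 0 \<le> \<nu> P"
    and linear_bar: "P \<in> \<P> \<Longrightarrow> linear (bar P)"
    and bar_comp: "P \<in> \<P> \<Longrightarrow> bar P \<circ> P = (\<lambda>_. 0)"
    and dual_bound: "P \<in> \<P> \<Longrightarrow>
      dual_norm N (adjoint P f + adjoint (bar P) g) \<le> max (dual_norm N f) (dual_norm N g)"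

definition weight_le ::
  "('e \<Rightarrow> 'e) set \<Rightarrow> (('e \<Rightarrow> 'e) \<Rightarrow> real) \<Rightarrow> real \<Rightarrow> ('e \<Rightarrow> 'e) set" where
  "weight_le \<P> \<nu> s = {P \<in> \<P>. \<nu> P \<le> s}"

definition cond_C ::
  "('e \<Rightarrow> real) \<Rightarrow> ('e \<Rightarrow> 'e) set \<Rightarrow> (('e \<Rightarrow> 'e) \<Rightarrow> real) \<Rightarrow> (('e \<Rightarrow> 'e) \<Rightarrow> 'e \<Rightarrow> 'e) \<Rightarrow>
   ('x \<Rightarrow> 'y) \<Rightarrow> ('x \<Rightarrow> 'e) \<Rightarrow> real \<Rightarrow> real \<Rightarrow> real \<Rightarrow> ('y \<Rightarrow> real) \<Rightarrow> bool" where
  "cond_C N \<P> \<nu> bar A B s \<gamma> \<beta> \<phi> \<longleftrightarrow>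
     (\<forall>z. \<forall>P \<in> weight_le \<P> \<nu> s.
        N (P (B z)) + N (B z) - N (bar P (B z)) \<le> \<beta> * \<phi> (A z) + \<gamma> * N (B z))"

text \<open>The optimal value of minimising \<open>N (B u)\<close> subject to \<open>\<phi> (A u - y) \<le> \<epsilon>\<close>. It is written as
  an infimum; for linear \<open>A\<close>, \<open>B\<close> between Euclidean spaces, norms \<open>N\<close>, \<open>\<phi>\<close> and a nonempty
  feasible set it is attained, because the image under \<open>B\<close> of the feasible set is the sum of a
  compact set and a subspace, hence closed.\<close>

definition Opt ::
  "('e \<Rightarrow> real) \<Rightarrow> ('x \<Rightarrow> 'y::real_vector) \<Rightarrow> ('x \<Rightarrow> 'e) \<Rightarrow> ('y \<Rightarrow> real) \<Rightarrow> 'y \<Rightarrow> real \<Rightarrow> real" where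
  "Opt N A B \<phi> y \<epsilon> = (INF u\<in>{u. \<phi> (A u - y) \<le> \<epsilon>}. N (B u))"

end

(* A norming functional of P w and one of (bar P) w turn axiom (A.3) into its primal form
   N (P w) + N (bar P w) <= N w. Applied to P (B x) + d with d = B xhat - B x, using P P = P and
   (bar P) P = 0, it gives N (bar P d) - N (P d) <= \<delta> + 2 \<delta>\<^sub>x, because N (B xhat) exceeds
   N (B x) by at most \<delta>. The condition C bounds N d + N (P d) - N (bar P d), and hence N d. *)

theory Submission
  imports Defs
begin

lemma
  assumes "is_norm N"
  shows is_norm_nonneg: "0 \<le> N v"
    and is_norm_eq_0_iff: "N v = 0 \<longleftrightarrow> v = 0"
    and is_norm_scaleR: "N (c *\<^sub>R v) = \<bar>c\<bar> * N v"
    and is_norm_triangle: "N (v + w) \<le> N v + N w"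
  using assms by (auto simp: is_norm_def)

lemma is_norm_zero: "is_norm N \<Longrightarrow> N 0 = 0"
  by (simp add: is_norm_eq_0_iff)

lemma is_norm_minus: "is_norm N \<Longrightarrow> N (- v) = N v"
  using is_norm_scaleR[of N "-1" v] by simp

lemma is_norm_triangle_diff: "is_norm N \<Longrightarrow> N (v - w) \<le> N v + N w"
  using is_norm_triangle[of N v "- w"] is_norm_minus[of N w] by simp

lemma is_norm_triangle_sub: "is_norm N \<Longrightarrow> N v \<le> N (v - w) + N w"
  using is_norm_triangle[of N "v - w" w] by simp

text \<open>Convexity is the route to continuity: a convex function on an open subset of a Euclidean
  space is continuous.\<close>

lemma is_norm_convex_on:
  assumes "is_norm N" shows "convex_on UNIV N"
proof (rule convex_onI)
  fix t :: real and v w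
  assume "0 < t" "t < 1"
  then show "N ((1 - t) *\<^sub>R v + t *\<^sub>R w) \<le> (1 - t) * N v + t * N w"
    using is_norm_triangle[OF assms, of "(1 - t) *\<^sub>R v" "t *\<^sub>R w"]
    by (simp add: is_norm_scaleR[OF assms])
qed simp

text \<open>By continuity \<open>N\<close> attains a minimum on the compact Euclidean unit sphere,
  which is positive because \<open>N\<close> vanishes only at 0. Homogeneity carries this bound from
  the sphere to all vectors.\<close>

lemma is_norm_bounded_unit_ball:
  fixes N :: "'a::euclidean_space \<Rightarrow> real"
  assumes "is_norm N"
  shows "bounded {v. N v \<le> 1}"
proof -
  have "continuous_on (sphere 0 1) N"
    using convex_on_continuous[OF open_UNIV is_norm_convex_on[OF assms]]
    by (rule continuous_on_subset) simp
  moreover have "sphere (0::'a) 1 \<noteq> {}"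
    by simp
  ultimately obtain u where u: "u \<in> sphere 0 1" and min: "\<And>v. v \<in> sphere 0 1 \<Longrightarrow> N u \<le> N v"
    using continuous_attains_inf[of "sphere (0::'a) 1" N] by auto
  have pos: "0 < N u"
    using u is_norm_nonneg[OF assms, of u] is_norm_eq_0_iff[OF assms, of u] by fastforce
  have "norm v \<le> 1 / N u" if "N v \<le> 1" for v
  proof (cases "v = 0")
    case True
    then show ?thesis using pos by simp
  next
    case False
    then have "N u \<le> N (inverse (norm v) *\<^sub>R v)"
      by (intro min) simp
    also have "\<dots> = N v / norm v"
      by (simp add: is_norm_scaleR[OF assms] divide_inverse)
    also have "\<dots> \<le> 1 / norm v"
      using that by (simp add: divide_right_mono)
    finally show ?thesis
      using pos False by (simp add: field_simps)
  qed
  then show ?thesis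
    unfolding bounded_iff by blast
qed

text \<open>Rescaling \<open>v\<close> to \<open>N\<close>-length 1 makes it a competitor in the
  supremum that defines \<open>dual_norm\<close>.\<close>

lemma inner_le_dual_norm:
  fixes N :: "'a::euclidean_space \<Rightarrow> real"
  assumes "is_norm N"
  shows "f \<bullet> v \<le> dual_norm N f * N v"
proof (cases "v = 0")
  case False
  then have pos: "0 < N v"
    using is_norm_nonneg[OF assms, of v] is_norm_eq_0_iff[OF assms, of v] by linarith
  obtain C where C: "\<And>v. N v \<le> 1 \<Longrightarrow> norm v \<le> C"
    using is_norm_bounded_unit_ball[OF assms] by (auto simp: bounded_iff)
  have "f \<bullet> v \<le> norm f * C" if "N v \<le> 1" for v
    using norm_cauchy_schwarz[of f v] mult_left_mono[OF C[OF that], of "norm f"] by simp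
  \<comment> \<open>A real \<open>SUP\<close> dominates its members only when they are bounded
    above; here Cauchy-Schwarz and the bounded unit ball ensure this.\<close>
  then have "bdd_above ((\<lambda>v. f \<bullet> v) ` {v. N v \<le> 1})"
    by (intro bdd_aboveI2[where M = "norm f * C"]) simp
  moreover have "inverse (N v) *\<^sub>R v \<in> {v. N v \<le> 1}"
    using pos by (simp add: is_norm_scaleR[OF assms])
  ultimately have "f \<bullet> (inverse (N v) *\<^sub>R v) \<le> dual_norm N f"
    unfolding dual_norm_def by (rule cSUP_upper[rotated])
  then show ?thesis
    using pos by (simp add: field_simps)
qed (simp add: is_norm_zero[OF assms])

lemma dual_norm_le:
  assumes "is_norm N" and "\<And>v. N v \<le> 1 \<Longrightarrow> f \<bullet> v \<le> c"
  shows "dual_norm N f \<le> c"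
proof -
  \<comment> \<open>The least-upper-bound property of a real \<open>SUP\<close> requires a nonempty
    index set.\<close>
  have "0 \<in> {v. N v \<le> 1}"
    using is_norm_zero[OF assms(1)] by simp
  then show ?thesis
    unfolding dual_norm_def using assms(2) by (intro cSUP_least) auto
qed

text \<open>A finite-dimensional Hahn-Banach argument: a hyperplane separates \<open>w\<close> from
  the open \<open>N\<close>-ball of radius \<open>N w\<close>, and its normal is rescaled to take
  the value \<open>N w\<close> at \<open>w\<close>.\<close>

lemma norming_functional:
  fixes N :: "'a::euclidean_space \<Rightarrow> real"
  assumes "is_norm N"
  obtains f where "dual_norm N f \<le> 1" and "f \<bullet> w = N w"
proof (cases "w = 0")
  case True
  show thesis
  proof
    show "dual_norm N 0 \<le> 1" by (rule dual_norm_le[OF assms]) simp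
    show "0 \<bullet> w = N w" using True is_norm_zero[OF assms] by simp
  qed
next
  case False
  define S where "S = {v. N v < N w}"
  have Nw: "0 < N w"
    using False is_norm_nonneg[OF assms, of w] is_norm_eq_0_iff[OF assms, of w] by linarith
  have "convex S"
  proof (rule convexI)
    fix v v' and t u :: real
    assume "v \<in> S" "v' \<in> S" "0 \<le> t" "0 \<le> u" "t + u = 1"
    then have "t * N v + u * N v' < N w"
      by (intro convex_bound_lt) (auto simp: S_def)
    then show "t *\<^sub>R v + u *\<^sub>R v' \<in> S"
      using is_norm_triangle[OF assms, of "t *\<^sub>R v" "u *\<^sub>R v'"] \<open>0 \<le> t\<close> \<open>0 \<le> u\<close>
      by (simp add: S_def is_norm_scaleR[OF assms])
  qed
  moreover have "0 \<in> S"
    using Nw is_norm_zero[OF assms] by (simp add: S_def)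
  then have "S \<noteq> {}"
    by blast
  moreover have "S \<inter> {w} = {}"
    by (simp add: S_def)
  ultimately obtain a b where "a \<noteq> 0" and "\<forall>v\<in>S. a \<bullet> v \<le> b" and "\<forall>v\<in>{w}. b \<le> a \<bullet> v"
    using separating_hyperplane_sets[of S "{w}"] by auto
  then have sep: "a \<bullet> v \<le> a \<bullet> w" if "N v < N w" for v
    using that by (force simp: S_def)
  \<comment> \<open>Comparing \<open>w\<close> with 0 yields only a nonnegative value. A small
    positive multiple of \<open>a\<close> inside the ball makes it strict; \<open>t\<close> is
    chosen to give that multiple \<open>N\<close>-length \<open>N w / 2\<close>.\<close>
  have aw: "0 < a \<bullet> w"
  proof -
    have Na: "0 < N a"
      using \<open>a \<noteq> 0\<close> is_norm_nonneg[OF assms, of a] is_norm_eq_0_iff[OF assms, of a] by linarith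
    define t where "t = N w / (2 * N a)"
    have "N (t *\<^sub>R a) < N w"
      using Na Nw by (simp add: t_def is_norm_scaleR[OF assms])
    then have "t * (a \<bullet> a) \<le> a \<bullet> w"
      using sep[of "t *\<^sub>R a"] by simp
    moreover have "0 < t * (a \<bullet> a)"
      using Na Nw \<open>a \<noteq> 0\<close> by (simp add: t_def)
    ultimately show ?thesis by linarith
  qed
  show thesis
  proof
    show "((N w / (a \<bullet> w)) *\<^sub>R a) \<bullet> w = N w"
      using aw by simp
    show "dual_norm N ((N w / (a \<bullet> w)) *\<^sub>R a) \<le> 1"
    proof (rule dual_norm_le[OF assms])
      fix v assume v: "N v \<le> 1"
      show "((N w / (a \<bullet> w)) *\<^sub>R a) \<bullet> v \<le> 1"
      \<comment> \<open>\<open>sep\<close> covers only the open ball, so vectors with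
        \<open>N v = 1\<close> are reached by shrinking with a factor \<open>t < 1\<close> and
        letting \<open>t\<close> tend to 1.\<close>
      proof (rule field_le_mult_one_interval)
        fix t :: real assume t: "0 < t" "t < 1"
        have "t * N w * N v \<le> t * N w * 1"
          using v t Nw by (intro mult_left_mono) auto
        also have "\<dots> < N w"
          using t Nw by simp
        finally have "N ((t * N w) *\<^sub>R v) < N w"
          using t Nw by (simp add: is_norm_scaleR[OF assms])
        from sep[OF this] show "t * (((N w / (a \<bullet> w)) *\<^sub>R a) \<bullet> v) \<le> 1"
          using aw by (simp add: field_simps)
      qed
    qed
  qed
qed

lemma (in sparsity_structure) norm_split_le:
  assumes "P \<in> \<P>"
  shows "N (P w) + N (bar P w) \<le> N w"
proof -
  obtain f where f: "dual_norm N f \<le> 1" "f \<bullet> P w = N (P w)"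
    by (rule norming_functional[OF norm])
  obtain g where g: "dual_norm N g \<le> 1" "g \<bullet> bar P w = N (bar P w)"
    by (rule norming_functional[OF norm])
  \<comment> \<open>The triangle inequality would not keep this sum in the dual unit ball; the
    maximum in \<open>dual_bound\<close> does.\<close>
  let ?h = "adjoint P f + adjoint (bar P) g"
  have "N (P w) + N (bar P w) = ?h \<bullet> w"
    using f(2) g(2) adjoint_works[OF linear_family[OF assms], of w f]
      adjoint_works[OF linear_bar[OF assms], of w g]
    by (simp add: inner_commute inner_add_right)
  also have "\<dots> \<le> dual_norm N ?h * N w"
    by (rule inner_le_dual_norm[OF norm])
  also have "\<dots> \<le> 1 * N w"
    using dual_bound[OF assms, of f g] f(1) g(1) is_norm_nonneg[OF norm]
    by (intro mult_right_mono) auto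
  finally show ?thesis by simp
qed

text \<open>Replacing \<open>w\<close> by \<open>P w\<close> makes the base point fixed by
  \<open>P\<close> and annihilated by \<open>bar P\<close>. The error \<open>w - P w\<close> is paid
  twice: in passing from \<open>P w + d\<close> to \<open>w + d\<close>, and from \<open>P w\<close>
  to \<open>w\<close>.\<close>

lemma (in sparsity_structure) norm_bar_minus_norm_le:
  assumes "P \<in> \<P>"
  shows "N (bar P d) - N (P d) \<le> N (w + d) - N w + 2 * N (w - P w)"
proof -
  interpret P: linear P by (rule linear_family[OF assms])
  interpret Q: linear "bar P" by (rule linear_bar[OF assms])
  have P: "P (P w + d) = P w + P d"
    using fun_cong[OF projector[OF assms], of w] by (simp add: P.add)
  have Q: "bar P (P w + d) = bar P d"
    using fun_cong[OF bar_comp[OF assms], of w] by (simp add: Q.add)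
  have "N (P w + P d) + N (bar P d) \<le> N (P w + d)"
    using norm_split_le[OF assms, of "P w + d"] by (simp only: P Q)
  moreover have "N (P w) \<le> N (P w + P d) + N (P d)"
    using is_norm_triangle_diff[OF norm, of "P w + P d" "P d"] by simp
  moreover have "N (P w + d) \<le> N (w + d) + N (w - P w)"
    using is_norm_triangle_diff[OF norm, of "w + d" "w - P w"] by (simp add: algebra_simps)
  moreover have "N w \<le> N (w - P w) + N (P w)"
    by (rule is_norm_triangle_sub[OF norm])
  ultimately show ?thesis by linarith
qed

text \<open>Nonnegativity of \<open>N\<close> bounds the objective below, so the real infimum is a
  genuine lower bound over the feasible points.\<close>

lemma Opt_le:
  assumes "is_norm N" and "\<phi> (A u - y) \<le> \<epsilon>"
  shows "Opt N A B \<phi> y \<epsilon> \<le> N (B u)"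
  unfolding Opt_def using assms
  by (intro cINF_lower bdd_belowI2[where m = 0]) (auto intro: is_norm_nonneg)

theorem proposition3p1:
  fixes A :: "'x::euclidean_space \<Rightarrow> real ^ 'm"
    and B :: "'x \<Rightarrow> 'e::euclidean_space"
    and \<phi> :: "real ^ 'm \<Rightarrow> real"
    and N :: "'e \<Rightarrow> real"
    and \<P> :: "('e \<Rightarrow> 'e) set"
    and \<nu> :: "('e \<Rightarrow> 'e) \<Rightarrow> real"
    and bar :: "('e \<Rightarrow> 'e) \<Rightarrow> 'e \<Rightarrow> 'e"
    and s \<gamma> \<beta> \<epsilon> \<delta>\<^sub>x \<delta>\<^sub>\<phi> \<delta> :: real
    and x xhat :: 'x
    and y \<xi> :: "real ^ 'm"
  assumes "linear A" and "linear B" and "is_norm \<phi>"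
    and "sparsity_structure N \<P> \<nu> bar"
    and "0 \<le> s"
    and "0 \<le> \<gamma>" and "\<gamma> < 1" and "0 \<le> \<beta>"
    and "cond_C N \<P> \<nu> bar A B s \<gamma> \<beta> \<phi>"
    and "0 \<le> \<epsilon>" and "y = A x + \<xi>" and "\<phi> \<xi> \<le> \<epsilon>"
    and "0 \<le> \<delta>\<^sub>x" and "0 \<le> \<delta>\<^sub>\<phi>" and "0 \<le> \<delta>"
    and "\<exists>P \<in> weight_le \<P> \<nu> s. N (B x - P (B x)) \<le> \<delta>\<^sub>x"
    and "\<phi> (A xhat - (A x + \<xi>)) \<le> \<epsilon> + \<delta>\<^sub>\<phi>"
    and "N (B xhat) \<le> Opt N A B \<phi> y \<epsilon> + \<delta>"
  shows "N (B xhat - B x) \<le> (\<beta> * (2 * \<epsilon> + \<delta>\<^sub>\<phi>) + \<delta> + 2 * \<delta>\<^sub>x) / (1 - \<gamma>)"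
proof -
  interpret sparsity_structure N \<P> \<nu> bar by fact
  obtain P where P: "P \<in> weight_le \<P> \<nu> s" "N (B x - P (B x)) \<le> \<delta>\<^sub>x"
    using assms(16) by blast
  define d where "d = B xhat - B x"
  \<comment> \<open>The true signal is feasible, its residual being \<open>- \<xi>\<close>; hence
    \<open>N (B xhat)\<close> exceeds \<open>N (B x)\<close> by at most \<delta>.\<close>
  have "\<phi> (A x - y) \<le> \<epsilon>"
    using \<open>y = A x + \<xi>\<close> \<open>\<phi> \<xi> \<le> \<epsilon>\<close> is_norm_minus[OF \<open>is_norm \<phi>\<close>] by simp
  then have "Opt N A B \<phi> y \<epsilon> \<le> N (B x)"
    by (rule Opt_le[where A = A, OF norm])
  moreover have "N (bar P d) - N (P d) \<le> N (B xhat) - N (B x) + 2 * N (B x - P (B x))"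
    using norm_bar_minus_norm_le[of P d "B x"] P(1) by (simp add: weight_le_def d_def)
  ultimately have bar_le: "N (bar P d) - N (P d) \<le> \<delta> + 2 * \<delta>\<^sub>x"
    using P(2) assms(18) by linarith
  have d: "B (xhat - x) = d"
    using \<open>linear B\<close> by (simp add: linear_diff d_def)
  \<comment> \<open>One \<epsilon> comes from the residual of \<open>xhat\<close>, together with
    \<open>\<delta>\<^sub>\<phi>\<close>, and the other from the noise \<open>\<xi>\<close>.\<close>
  have "A (xhat - x) = (A xhat - (A x + \<xi>)) + \<xi>"
    using \<open>linear A\<close> by (simp add: linear_diff)
  then have "\<phi> (A (xhat - x)) \<le> 2 * \<epsilon> + \<delta>\<^sub>\<phi>"
    using is_norm_triangle[OF \<open>is_norm \<phi>\<close>, of "A xhat - (A x + \<xi>)" \<xi>] assms(12,17) by simp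
  then have "\<beta> * \<phi> (A (xhat - x)) \<le> \<beta> * (2 * \<epsilon> + \<delta>\<^sub>\<phi>)"
    using \<open>0 \<le> \<beta>\<close> by (rule mult_left_mono)
  moreover have "N (P d) + N d - N (bar P d) \<le> \<beta> * \<phi> (A (xhat - x)) + \<gamma> * N d"
    using assms(9) P(1) unfolding cond_C_def d[symmetric] by blast
  \<comment> \<open>Adding \<open>bar_le\<close> to the condition at \<open>z = xhat - x\<close>
    cancels \<open>N (P d)\<close> and \<open>N (bar P d)\<close>; the term
    \<open>\<gamma> * N d\<close> is then absorbed on the left.\<close>
  ultimately have "N d * (1 - \<gamma>) \<le> \<beta> * (2 * \<epsilon> + \<delta>\<^sub>\<phi>) + \<delta> + 2 * \<delta>\<^sub>x"
    using bar_le by (simp add: algebra_simps)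
  then show ?thesis
    using \<open>\<gamma> < 1\<close> by (simp add: pos_le_divide_eq d_def)
qed

end
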